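(* Let $N\ge 1$ and let $F_1,\dots,F_N$ and $\tilde F_1,\dots,\tilde F_N$ be nonzero complex numbers. Let $H$ (resp. $\tilde H$) be the $(N+1)\times(N+1)$ Hermitian tridiagonal matrix with zero diagonal, superdiagonal entries $H_{n,n+1}=F_n$ (resp. $\tilde H_{n,n+1}=\tilde F_n$) for $1\le n\le N$, and subdiagonal entries the complex conjugates of these. Let $H_0$ be the $(N+1)\times(N+1)$ matrix with $(H_0)_{n,m}=1$ if $|n-m|=1$ and $0$ otherwise. Let $A=\mathrm{diag}(A_1,\dots,A_{N+1})$ and $\tilde A=\mathrm{diag}(\tilde A_1,\dots,\tilde A_{N+1})$ be invertible diagonal matrices with $A_n\overline{A_{n+1}}=F_n$ and $\tilde A_n\overline{\tilde A_{n+1}}=\tilde F_n$ for $1\le n\le N$, so that $$H=AH_0A^\dagger,\qquad \tilde H=\tilde AH_0\tilde A^\dagger .$$ Suppose $\sigma(H)=\sigma(\tilde H)$, and let $U$ be a unitary matrix with $UHU^\dagger=\tilde H$. Then the matrix $X=\tilde A^{-1}UA$ satisfies $$XH_0X^\dagger=H_0,$$ and the unitarity of $U=\tilde AXA^{-1}$ implies in addition $$X\,\tilde A^\dagger\tilde A\,X^\dagger=A^\dagger A .$$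
   Context: $\dagger$ denotes the conjugate transpose and $\sigma(\cdot)$ the set of eigenvalues. The matrix $H_0$ is the Hamiltonian of the homogeneous chain with all couplings equal to $1$.
   Formalization: The last identity is proved as X†Ã†ÃX = A†A (dagger on the left factor X); the printed X Ã†Ã X† = A†A is false, e.g. for N=1, F=F̃=1, A=diag(2,1/2), Ã=I, U the swap matrix. *)

theory Defs
  imports
    "Jordan_Normal_Form.Spectral_Radius"
    "Jordan_Normal_Form.Schur_Decomposition"
    "Jordan_Normal_Form.Gauss_Jordan_Elimination"
begin

(* Matrix positions are 0-based in the library, whereas F and the diagonals d are 1-based:
   position (i, j) below is entry (i + 1, j + 1) of the matrix. *)

definition chain_mat :: "nat \<Rightarrow> (nat \<Rightarrow> complex) \<Rightarrow> complex mat" where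
  "chain_mat N F = mat (N + 1) (N + 1)
     (\<lambda>(i, j). if j = i + 1 then F (i + 1)
              else if i = j + 1 then cnj (F (j + 1))
              else 0)"

definition homogeneous_chain_mat :: "nat \<Rightarrow> complex mat" where
  "homogeneous_chain_mat N = mat (N + 1) (N + 1)
     (\<lambda>(i, j). if \<bar>int i - int j\<bar> = 1 then 1 else 0)"

definition diag_mat1 :: "nat \<Rightarrow> (nat \<Rightarrow> complex) \<Rightarrow> complex mat" where
  "diag_mat1 n d = mat_diag n (\<lambda>i. d (i + 1))"

definition unitary_mat :: "nat \<Rightarrow> complex mat \<Rightarrow> bool" where
  "unitary_mat n U \<longleftrightarrow>
     U \<in> carrier_mat n n \<and> U * mat_adjoint U = 1\<^sub>m n \<and> mat_adjoint U * U = 1\<^sub>m n"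

(* Meaningful for invertible square matrices only. *)
definition mat_inv :: "complex mat \<Rightarrow> complex mat" where
  "mat_inv M = the (mat_inverse M)"

end

theory Submission
  imports Defs
begin

lemma mat_adjoint_carrier [simp]:
  "A \<in> carrier_mat nr nc \<Longrightarrow> mat_adjoint A \<in> carrier_mat nc nr"
  by (auto simp: mat_adjoint_def)

lemma index_mat_adjoint:
  "i < dim_col A \<Longrightarrow> j < dim_row A \<Longrightarrow> mat_adjoint A $$ (i, j) = conjugate (A $$ (j, i))"
  by (simp add: mat_adjoint_def mat_of_rows_index)

lemma mat_adjoint_mult:
  fixes A B :: "'a :: conjugatable_field mat"
  assumes "A \<in> carrier_mat nr n" "B \<in> carrier_mat n nc"
  shows "mat_adjoint (A * B) = mat_adjoint B * mat_adjoint A"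
proof (rule eq_matI)
  fix i j assume "i < dim_row (mat_adjoint B * mat_adjoint A)"
    "j < dim_col (mat_adjoint B * mat_adjoint A)"
  then have ij: "i < nc" "j < nr"
    using assms mat_adjoint_carrier[OF assms(1)] mat_adjoint_carrier[OF assms(2)] by auto
  have "mat_adjoint (A * B) $$ (i, j) = conjugate (\<Sum>k<n. A $$ (j, k) * B $$ (k, i))"
    using assms ij by (simp add: index_mat_adjoint scalar_prod_def atLeast0LessThan)
  also have "\<dots> = (\<Sum>k<n. mat_adjoint B $$ (i, k) * mat_adjoint A $$ (k, j))"
    using assms ij
    by (simp add: sum_conjugate conjugate_dist_mul index_mat_adjoint mult.commute)
  also have "\<dots> = (mat_adjoint B * mat_adjoint A) $$ (i, j)"
    using ij carrier_matD[OF mat_adjoint_carrier[OF assms(1)]]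
      carrier_matD[OF mat_adjoint_carrier[OF assms(2)]]
    by (simp add: scalar_prod_def atLeast0LessThan)
  finally show "mat_adjoint (A * B) $$ (i, j) = (mat_adjoint B * mat_adjoint A) $$ (i, j)" .
qed (use assms in \<open>auto simp: mat_adjoint_def\<close>)

lemma mat_adjoint_one: "mat_adjoint (1\<^sub>m n :: complex mat) = 1\<^sub>m n"
  by (rule eq_matI) (auto simp: index_mat_adjoint, auto simp: mat_adjoint_def)

lemma mat_adjoint_mat_diag:
  "mat_adjoint (mat_diag n f :: complex mat) = mat_diag n (\<lambda>i. cnj (f i))"
  by (rule eq_matI)
    (auto simp: index_mat_adjoint mat_diag_def, auto simp: mat_adjoint_def)

lemma mat_inv_inverse:
  assumes A: "A \<in> carrier_mat n n" and "invertible_mat A"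
  shows "A * mat_inv A = 1\<^sub>m n" "mat_inv A * A = 1\<^sub>m n" "mat_inv A \<in> carrier_mat n n"
proof -
  obtain B where B: "A * B = 1\<^sub>m n" "B * A = 1\<^sub>m (dim_row B)"
    using assms by (auto simp: invertible_mat_def inverts_mat_def)
  then have "B \<in> carrier_mat n n"
    using A by (metis carrier_matD(2) carrier_matI index_mult_mat(3) index_one_mat(3))
  then have "A \<in> Units (ring_mat TYPE(complex) n ())"
    using A B by (auto simp: Units_def ring_mat_def)
  then obtain C where "mat_inverse A = Some C"
    using mat_inverse(1)[OF A, of "()"] by blast
  then show "A * mat_inv A = 1\<^sub>m n" "mat_inv A * A = 1\<^sub>m n" "mat_inv A \<in> carrier_mat n n"
    using mat_inverse(2)[OF A] by (auto simp: mat_inv_def)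
qed

lemma chain_mat_factorization:
  assumes "\<And>n. n \<in> {1..N} \<Longrightarrow> d n * cnj (d (n + 1)) = F n"
  shows "chain_mat N F =
    diag_mat1 (N + 1) d * homogeneous_chain_mat N * mat_adjoint (diag_mat1 (N + 1) d)"
proof -
  have H0: "homogeneous_chain_mat N \<in> carrier_mat (N + 1) (N + 1)"
    by (simp add: homogeneous_chain_mat_def)
  have upper: "d (Suc i) * cnj (d (Suc (Suc i))) = F (Suc i)" if "i < N" for i
    using assms[of "Suc i"] that by simp
  have lower: "d (Suc (Suc i)) * cnj (d (Suc i)) = cnj (F (Suc i))" if "i < N" for i
    using upper[OF that] by (metis complex_cnj_cnj complex_cnj_mult mult.commute)
  show ?thesis
    unfolding diag_mat1_def mat_adjoint_mat_diag mat_diag_mult_left[OF H0]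
    by (subst mat_diag_mult_right[of _ "N + 1"], simp, rule eq_matI)
      (auto simp: chain_mat_def homogeneous_chain_mat_def upper lower)
qed

theorem mainTheorem4:
  fixes N :: nat
    and F Ft d dt :: "nat \<Rightarrow> complex"
    and H Ht H0 A At U X :: "complex mat"
  assumes "N \<ge> 1"
    and "\<And>n. n \<in> {1..N} \<Longrightarrow> F n \<noteq> 0"
    and "\<And>n. n \<in> {1..N} \<Longrightarrow> Ft n \<noteq> 0"
    and "H = chain_mat N F"
    and "Ht = chain_mat N Ft"
    and "H0 = homogeneous_chain_mat N"
    and "A = diag_mat1 (N + 1) d"
    and "At = diag_mat1 (N + 1) dt"
    and "invertible_mat A"
    and "invertible_mat At"
    and "\<And>n. n \<in> {1..N} \<Longrightarrow> d n * cnj (d (n + 1)) = F n"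
    and "\<And>n. n \<in> {1..N} \<Longrightarrow> dt n * cnj (dt (n + 1)) = Ft n"
    and "spectrum H = spectrum Ht"
    and "unitary_mat (N + 1) U"
    and "U * H * mat_adjoint U = Ht"
    and "X = mat_inv At * U * A"
  shows "H = A * H0 * mat_adjoint A \<and>
         Ht = At * H0 * mat_adjoint At \<and>
         X * H0 * mat_adjoint X = H0 \<and>
         U = At * X * mat_inv A \<and>
         mat_adjoint X * (mat_adjoint At * At) * X = mat_adjoint A * A"
proof -
  define n where "n = N + 1"
  define B where "B = mat_inv A"
  define Bt where "Bt = mat_inv At"
  have A: "A \<in> carrier_mat n n" and At: "At \<in> carrier_mat n n"
    and H0: "H0 \<in> carrier_mat n n"
    using assms(6-8) by (simp_all add: n_def diag_mat1_def homogeneous_chain_mat_def)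
  have U: "U \<in> carrier_mat n n" and UU: "mat_adjoint U * U = 1\<^sub>m n"
    using assms(14) by (simp_all add: n_def unitary_mat_def)
  have B: "A * B = 1\<^sub>m n" "B \<in> carrier_mat n n"
    using mat_inv_inverse[OF A assms(9)] by (simp_all add: B_def)
  have Bt: "At * Bt = 1\<^sub>m n" "Bt * At = 1\<^sub>m n" "Bt \<in> carrier_mat n n"
    using mat_inv_inverse[OF At assms(10)] by (simp_all add: Bt_def)
  have X_eq: "X = Bt * U * A"
    using assms(16) by (simp add: Bt_def)
  have X: "X \<in> carrier_mat n n"
    using A U Bt(3) by (simp add: X_eq)
  have H: "H = A * H0 * mat_adjoint A"
    unfolding assms(4,6,7) by (rule chain_mat_factorization) (fact assms(11))
  have Ht: "Ht = At * H0 * mat_adjoint At"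
    unfolding assms(5,6,8) by (rule chain_mat_factorization) (fact assms(12))
  note assoc = assoc_mult_mat[of _ n n _ n _ n]
  note carrier = A At H0 U B(2) Bt(3) X mult_carrier_mat[of _ n n _ n]
    mat_adjoint_carrier[of _ n n]
  note adjoint_mult = mat_adjoint_mult[of _ n n _ n]
  have AtX: "At * X = U * A"
  proof -
    have "At * X = (At * Bt) * (U * A)"
      unfolding X_eq by (simp add: assoc carrier)
    then show ?thesis
      using Bt(1) A U by simp
  qed
  have "X * H0 * mat_adjoint X = Bt * (U * H * mat_adjoint U) * mat_adjoint Bt"
    unfolding X_eq H by (simp add: assoc carrier adjoint_mult)
  also have "\<dots> = (Bt * At) * H0 * mat_adjoint (Bt * At)"
    unfolding assms(15) Ht by (simp add: assoc carrier adjoint_mult)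
  also have "\<dots> = H0"
    unfolding Bt(2) using H0 by (simp add: mat_adjoint_one)
  finally have XH0: "X * H0 * mat_adjoint X = H0" .
  have "At * X * B = U * (A * B)"
    unfolding AtX by (simp add: assoc carrier)
  then have U_eq: "U = At * X * B"
    using B(1) U by simp
  have "mat_adjoint X * (mat_adjoint At * At) * X = mat_adjoint (At * X) * (At * X)"
    by (simp add: assoc carrier adjoint_mult)
  also have "\<dots> = mat_adjoint A * ((mat_adjoint U * U) * A)"
    unfolding AtX by (simp add: assoc carrier adjoint_mult)
  also have "\<dots> = mat_adjoint A * A"
    unfolding UU using A by simp
  finally show ?thesis
    using H Ht XH0 U_eq by (simp add: B_def)
qed

end
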